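(* Let $f:L\rightarrow L$ be a continuous map, where $L$ is the combinatorial model of the real line. Then $f$ does not have a periodic point of period $3$.
   Context: $L=\{x_i\}_{i\in\mathbb{Z}}$ (the $x_i$ pairwise distinct) is the poset, called the combinatorial model of the real line, whose only strict relations are $x_i<x_{i+1}>x_{i+2}$ for every odd $i\in\mathbb{Z}$; thus points of odd index are minimal, points of even index are maximal, and each even-indexed $x_i$ lies above exactly $x_{i-1}$ and $x_{i+1}$. $L$ is regarded as an Alexandroff $T_0$-space, the smallest open set containing $x$ being $U_x=\{y\in L: y\leq x\}$; a map $f:L\to L$ is continuous if and only if it is order-preserving ($x\leq y$ implies $f(x)\leq f(y)$). A point $x$ is a periodic point of period $n$ of $f$ if $n$ is the smallest positive integer with $f^n(x)=x$. *)

theory Defs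
  imports Complex_Main
begin

text \<open>
  The combinatorial model of the real line: \<open>X i\<close> is the point $x_i$, so that the points
  are pairwise distinct and \<open>UNIV :: zline set\<close> is the whole space $L$.
\<close>

datatype zline = X int

instantiation zline :: order
begin

definition less_zline :: "zline \<Rightarrow> zline \<Rightarrow> bool" where
  "a < b \<longleftrightarrow> (\<exists>i. odd i \<and> b = X (i + 1) \<and> (a = X i \<or> a = X (i + 2)))"

definition less_eq_zline :: "zline \<Rightarrow> zline \<Rightarrow> bool" where
  "a \<le> b \<longleftrightarrow> a < b \<or> a = (b :: zline)"

instance
proof
  have asym: False if "a < b" "b < c" for a b c :: zline
    using that by (auto simp: less_zline_def)
  have irr: "\<not> a < a" for a :: zline
    by (auto simp: less_zline_def)
  fix a b c :: zline
  show "a < b \<longleftrightarrow> a \<le> b \<and> \<not> b \<le> a"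
    using asym irr by (auto simp: less_eq_zline_def)
  show "a \<le> a" by (simp add: less_eq_zline_def)
  show "a \<le> c" if "a \<le> b" "b \<le> c"
    using that asym by (auto simp: less_eq_zline_def)
  show "a = b" if "a \<le> b" "b \<le> a"
    using that asym by (auto simp: less_eq_zline_def)
qed

end

text \<open>
  The Alexandroff topology of the poset, with basis the sets $U_x = \{y.\ y \le x\}$:
  open sets are the down-closed sets.
\<close>

instantiation zline :: topological_space
begin

definition open_zline :: "zline set \<Rightarrow> bool" where
  "open (U :: zline set) \<longleftrightarrow> (\<forall>x\<in>U. {y. y \<le> x} \<subseteq> U)"

instance
proof
  show "open (UNIV :: zline set)"
    by (simp add: open_zline_def)
  show "open (S \<inter> T)" if "open S" "open T" for S T :: "zline set"
    using that unfolding open_zline_def by blast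
  show "open (\<Union>K)" if "\<forall>S\<in>K. open S" for K :: "zline set set"
    using that unfolding open_zline_def by blast
qed

end

instance zline :: t0_space
proof
  fix x y :: zline
  assume "x \<noteq> y"
  have op: "open {z. z \<le> w}" for w :: zline
    unfolding open_zline_def by (auto intro: order_trans)
  show "\<exists>U. open U \<and> (x \<in> U) \<noteq> (y \<in> U)"
  proof (cases "x \<le> y")
    case True
    with \<open>x \<noteq> y\<close> have "\<not> y \<le> x" by auto
    then show ?thesis using op[of x] by (intro exI[of _ "{z. z \<le> x}"]) auto
  next
    case False
    then show ?thesis using op[of y] by (intro exI[of _ "{z. z \<le> y}"]) auto
  qed
qed

lemma zline_minimal_open:
  fixes x :: zline
  shows "open {y. y \<le> x}" and "open U \<Longrightarrow> x \<in> U \<Longrightarrow> {y. y \<le> x} \<subseteq> U"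
  by (auto simp: open_zline_def intro: order_trans)

lemma continuous_on_zline_iff_mono:
  fixes f :: "zline \<Rightarrow> zline"
  shows "continuous_on UNIV f \<longleftrightarrow> mono f"
proof
  assume c: "continuous_on UNIV f"
  show "mono f"
  proof (rule monoI)
    fix x y :: zline
    assume "x \<le> y"
    have "open (f -` {z. z \<le> f y})"
      using c zline_minimal_open(1)[of "f y"] by (simp add: continuous_on_open_vimage del: vimage_Collect_eq)
    from zline_minimal_open(2)[OF this, of y] \<open>x \<le> y\<close> show "f x \<le> f y"
      by auto
  qed
next
  assume "mono f"
  then show "continuous_on UNIV f"
    by (auto simp: continuous_on_open_vimage open_zline_def dest: monoD)
qed

definition periodic_point_of_period :: "('a \<Rightarrow> 'a) \<Rightarrow> nat \<Rightarrow> 'a \<Rightarrow> bool" where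
  "periodic_point_of_period f n x \<longleftrightarrow>
     0 < n \<and> (f ^^ n) x = x \<and> (\<forall>m. 0 < m \<and> (f ^^ m) x = x \<longrightarrow> n \<le> m)"

end

theory Submission
  imports Defs
begin

text \<open>
  Two points of $L$ are comparable exactly when their indices differ by at most one, so an
  order-preserving map sends neighbours to neighbours or to the same point. Hence a continuous
  \<open>f\<close> is 1-Lipschitz for the distance $|i - j|$ between $x_i$ and $x_j$
  (\<open>mono_zline_nonexpanding\<close>). Along an orbit $x, f(x), f^2(x), f^3(x) = x$ the distances of
  consecutive points therefore never increase; since the orbit closes up, the three mutual
  distances are equal. Three integers cannot be mutually equidistant unless they coincide, so
  $f(x) = x$ and the period is 1 rather than 3.
\<close>

primrec index :: "zline \<Rightarrow> int" where
  "index (X i) = i"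

lemma index_eq_iff: "index a = index b \<longleftrightarrow> a = b"
  by (cases a; cases b) simp

lemma zline_le_index_dist: "a \<le> b \<Longrightarrow> \<bar>index a - index b\<bar> \<le> 1"
  by (auto simp: less_eq_zline_def less_zline_def)

lemma zline_neighbours_comparable: "X i \<le> X (i + 1) \<or> X (i + 1) \<le> X i"
proof (cases "odd i")
  case True
  then show ?thesis by (auto simp: less_eq_zline_def less_zline_def)
next
  case False
  \<comment> \<open>An even point lies above its right neighbour; the odd index witnessing this is the left
    neighbour's.\<close>
  then have "X (i + 1) < X i"
    unfolding less_zline_def by (intro exI[of _ "i - 1"]) auto
  then show ?thesis by (simp add: less_eq_zline_def)
qed

text \<open>
  Monotone maps preserve comparability, so each unit step moves the image by at most one; a walk
  of unit steps from one point to the other gives the bound in general.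
\<close>

lemma mono_zline_nonexpanding:
  assumes "mono f"
  shows "\<bar>index (f a) - index (f b)\<bar> \<le> \<bar>index a - index b\<bar>"
proof -
  have unit_step: "\<bar>index (f (X i)) - index (f (X (i + 1)))\<bar> \<le> 1" for i
    using zline_neighbours_comparable[of i] monoD[OF assms] zline_le_index_dist
    by (metis abs_minus_commute)
  have walk: "\<bar>index (f (X i)) - index (f (X (i + int n)))\<bar> \<le> int n" for i n
  proof (induction n)
    case (Suc n)
    then show ?case using unit_step[of "i + int n"] by (simp add: algebra_simps)
  qed simp
  obtain i j where ij: "a = X i" "b = X j"
    by (cases a, cases b)
  show ?thesis
    using walk[of i "nat (j - i)"] walk[of j "nat (i - j)"] ij
    by (cases "i \<le> j") (auto simp: abs_minus_commute)
qed

theorem proposition3p3: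
  fixes f :: "zline \<Rightarrow> zline"
  assumes "continuous_on UNIV f"
  shows "\<not> (\<exists>x. periodic_point_of_period f 3 x)"
proof
  assume "\<exists>x. periodic_point_of_period f 3 x"
  then obtain x where closed: "f (f (f x)) = x"
    and least: "\<And>m. 0 < m \<Longrightarrow> (f ^^ m) x = x \<Longrightarrow> 3 \<le> m"
    by (auto simp: periodic_point_of_period_def eval_nat_numeral)
  have "mono f"
    using assms by (simp add: continuous_on_zline_iff_mono)
  note nonexp = mono_zline_nonexpanding[OF this]
  have "index (f x) = index x"
    using nonexp[of x "f x"] nonexp[of "f x" "f (f x)"] nonexp[of "f (f x)" x] closed
    by simp
  then have "(f ^^ 1) x = x"
    by (simp add: index_eq_iff)
  then show False
    using least[of 1] by simp
qed

end
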